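(* Let ${\rm XB}(\mu,\phi,u)$ denote the extended-support beta distribution with $\mu\in(0,1)$, $\phi>0$, $u\ge 0$, i.e. the distribution of $\max(\min(Y^*,1),0)$ where $Y^* \sim {\rm B4}(\mu,\phi,-u,1+u)$. Then: 1. For $u=0$, ${\rm XB}(\mu,\phi,0)$ is the beta distribution with density $f_{\rm (B)}(y\mid\mu,\phi)$. 2. As $u\to\infty$ with the mean and variance of the latent variable $Y^*$ held fixed, the XB distribution converges to the normal distribution censored in $[0,1]$. That is: fix $\mu_*\in\mathbb{R}$ and $\sigma_*\in(0,\infty)$, and for all sufficiently large $u$ let $Y_u \sim {\rm XB}(\mu_u,\phi_u,u)$, where $\mu_u\in(0,1)$ and $\phi_u>0$ are such that a random variable $Y^*_u\sim{\rm B4}(\mu_u,\phi_u,-u,1+u)$ has $\mathrm{E}(Y^*_u)=\mu_*$ and $\mathrm{var}(Y^*_u)=\sigma_*^2$; then, as $u\to\infty$, $Y_u$ converges in distribution to $\max(\min(\mu_*+\sigma_*Z,1),0)$, where $Z$ is a standard normal random variable.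
   Context: For $\mu \in (0,1)$ and $\phi > 0$, the beta density in the mean-precision parameterization is $$f_{\rm (B)}(y \mid \mu,\phi) = \frac{I(0<y<1)}{B(\mu\phi,(1-\mu)\phi)}\, y^{\mu\phi-1}(1-y)^{(1-\mu)\phi-1},$$ where $B(\cdot,\cdot)$ is the beta function and $I(A)$ is $1$ if $A$ is true and $0$ otherwise. For $u\ge 0$, the four-parameter beta distribution with symmetric exceedance, ${\rm B4}(\mu,\phi,-u,1+u)$, has density $$f_{\rm (B4)}(y \mid \mu,\phi,-u,1+u) = f_{\rm (B)}\left(\frac{y+u}{1+2u} \,\Big|\, \mu,\phi\right)\frac{1}{1+2u}, \qquad y\in\mathbb{R}.$$ The normal distribution with mean $\mu_*$ and variance $\sigma_*^2$ censored in $[0,1]$ is the distribution of $\max(\min(W,1),0)$ with $W$ normal with mean $\mu_*$ and variance $\sigma_*^2$. *)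

theory Defs
  imports "HOL-Probability.Probability"
begin

definition beta_density :: "real \<Rightarrow> real \<Rightarrow> real \<Rightarrow> real" where
  "beta_density \<mu> \<phi> y =
     indicator {0<..<1} y / Beta (\<mu> * \<phi>) ((1 - \<mu>) * \<phi>)
       * y powr (\<mu> * \<phi> - 1) * (1 - y) powr ((1 - \<mu>) * \<phi> - 1)"

definition beta_distribution :: "real \<Rightarrow> real \<Rightarrow> real measure" where
  "beta_distribution \<mu> \<phi> = density lborel (\<lambda>y. ennreal (beta_density \<mu> \<phi> y))"

(* Symmetric exceedance only: the support endpoints are -u and 1 + u. *)
definition B4_density :: "real \<Rightarrow> real \<Rightarrow> real \<Rightarrow> real \<Rightarrow> real" where
  "B4_density \<mu> \<phi> u y = beta_density \<mu> \<phi> ((y + u) / (1 + 2 * u)) * (1 / (1 + 2 * u))"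

definition B4 :: "real \<Rightarrow> real \<Rightarrow> real \<Rightarrow> real measure" where
  "B4 \<mu> \<phi> u = density lborel (\<lambda>y. ennreal (B4_density \<mu> \<phi> u y))"

definition censor01 :: "real \<Rightarrow> real" where
  "censor01 y = max (min y 1) 0"

definition XB :: "real \<Rightarrow> real \<Rightarrow> real \<Rightarrow> real measure" where
  "XB \<mu> \<phi> u = distr (B4 \<mu> \<phi> u) borel censor01"

(* The library's weak_conv_m covers sequences only; this is the same notion along
   an arbitrary filter, needed because u tends to infinity through the reals. *)
definition weak_conv_along :: "('i \<Rightarrow> real measure) \<Rightarrow> real measure \<Rightarrow> 'i filter \<Rightarrow> bool" where
  "weak_conv_along M N F \<longleftrightarrow>
     (\<forall>x. isCont (cdf N) x \<longrightarrow> ((\<lambda>i. cdf (M i) x) \<longlongrightarrow> cdf N x) F)"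

lemma weak_conv_along_sequentially: "weak_conv_along M N sequentially \<longleftrightarrow> weak_conv_m M N"
  by (simp add: weak_conv_along_def weak_conv_m_def weak_conv_def)

(* Admissible B4 parameters whose latent variable has mean m and variance s^2. *)
definition latent_moments :: "real \<Rightarrow> real \<Rightarrow> real \<Rightarrow> real \<Rightarrow> real \<Rightarrow> bool" where
  "latent_moments m s u \<mu> \<phi> \<longleftrightarrow>
     0 < \<mu> \<and> \<mu> < 1 \<and> 0 < \<phi> \<and>
     prob_space.expectation (B4 \<mu> \<phi> u) (\<lambda>y. y) = m \<and>
     prob_space.variance (B4 \<mu> \<phi> u) (\<lambda>y. y) = s\<^sup>2"

end

(* The moment conditions determine the parameters explicitly. Writing p = m + u, q = 1 + u - m,
   they force mu = p / (p + q) and phi = p q / s^2 - 1. Standardising z = (y - m) / s, the density of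
   the latent variable is then a constant multiple of
     h_u(z) = (1 + s z / p)^(mu phi - 1) (1 - s z / q)^((1 - mu) phi - 1),
   which tends pointwise to exp(- z^2 / 2) and is dominated by a Gaussian, because
   ln (1 + x) <= x - x^2 / 8 on (-1, 3]. Hence the probability of every Borel set, being a quotient of
   two integrals of h_u, converges to the normal probability; the normalising Beta function cancels
   and no Stirling formula is needed. *)
theory Submission
  imports Defs "HOL-Real_Asymp.Real_Asymp"
begin

section \<open>Moments of the beta density\<close>

text \<open>Since the integrand is nonnegative, its gauge integral is also its Lebesgue integral.
  Endpoints form a null set, so the closed interval may be opened.\<close>

lemma has_bochner_integral_Beta:
  fixes a b :: real
  assumes "0 < a" "0 < b"
  shows "has_bochner_integral lborel
           (\<lambda>y. indicator {0<..<1} y * (y powr (a - 1) * (1 - y) powr (b - 1))) (Beta a b)"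
proof (rule has_bochner_integral_nn_integral)
  have "((\<lambda>x. x powr (a - 1) * (1 - x) powr (b - 1)) has_integral Beta a b) {0<..<1}"
    using has_integral_Beta_real[OF assms] by (simp add: has_integral_Icc_iff_Ioo)
  from nn_integral_has_integral_lebesgue[OF _ this]
  show "(\<integral>\<^sup>+y. ennreal (indicator {0<..<1} y * (y powr (a - 1) * (1 - y) powr (b - 1))) \<partial>lborel)
          = ennreal (Beta a b)"
    by (simp add: ennreal_mult' ennreal_indicator)
  show "0 \<le> Beta a b"
    using assms by (simp add: Beta_def Gamma_real_pos less_imp_le)
qed auto

lemma Beta_real_pos: "0 < a \<Longrightarrow> 0 < b \<Longrightarrow> 0 < Beta a (b :: real)"
  by (simp add: Beta_def Gamma_real_pos)

lemma beta_density_nonneg: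
  assumes "0 < \<mu>" "\<mu> < 1" "0 < \<phi>"
  shows "0 \<le> beta_density \<mu> \<phi> y"
  using assms by (simp add: beta_density_def Beta_real_pos less_imp_le)

lemma borel_measurable_beta_density [measurable]: "beta_density \<mu> \<phi> \<in> borel_measurable borel"
  unfolding beta_density_def[abs_def] by measurable

lemma borel_measurable_B4_density [measurable]: "B4_density \<mu> \<phi> u \<in> borel_measurable borel"
  unfolding B4_density_def[abs_def] by measurable

lemma borel_measurable_censor01 [measurable]: "censor01 \<in> borel_measurable borel"
  unfolding censor01_def[abs_def] by measurable

text \<open>A factor \<open>y ^ k\<close> merely raises the first exponent by \<open>k\<close>, so
  each raw moment is again a Beta integral over the same normalising constant.\<close>

lemma beta_density_raw_moment:
  assumes "0 < \<mu>" "\<mu> < 1" "0 < \<phi>"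
  shows "has_bochner_integral lborel (\<lambda>y. beta_density \<mu> \<phi> y * y ^ k)
           (Beta (\<mu> * \<phi> + k) ((1 - \<mu>) * \<phi>) / Beta (\<mu> * \<phi>) ((1 - \<mu>) * \<phi>))"
proof -
  have "has_bochner_integral lborel
      (\<lambda>y. indicator {0<..<1} y * (y powr (\<mu> * \<phi> + k - 1) * (1 - y) powr ((1 - \<mu>) * \<phi> - 1))
          / Beta (\<mu> * \<phi>) ((1 - \<mu>) * \<phi>))
      (Beta (\<mu> * \<phi> + k) ((1 - \<mu>) * \<phi>) / Beta (\<mu> * \<phi>) ((1 - \<mu>) * \<phi>))"
    using assms by (intro has_bochner_integral_divide_zero has_bochner_integral_Beta) (auto simp: add_pos_nonneg)
  moreover have "indicator {0<..<1} y * (y powr (\<mu> * \<phi> + k - 1) * (1 - y) powr ((1 - \<mu>) * \<phi> - 1))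
          / Beta (\<mu> * \<phi>) ((1 - \<mu>) * \<phi>) = beta_density \<mu> \<phi> y * y ^ k" for y
  \<comment> \<open>Merging \<open>y ^ k\<close> into the power needs \<open>0 < y\<close>; outside
    the unit interval the indicator makes both sides zero.\<close>
  proof (cases "y \<in> {0<..<1}")
    case True
    then have "y powr (\<mu> * \<phi> + k - 1) = y powr (\<mu> * \<phi> - 1) * y ^ k"
      by (simp add: powr_realpow[symmetric] powr_add[symmetric] algebra_simps)
    then show ?thesis by (simp add: beta_density_def)
  qed (simp add: beta_density_def)
  ultimately show ?thesis by simp
qed

text \<open>The recurrence \<open>(a + b) * Beta (a + 1) b = a * Beta a b\<close> evaluates the
  first two raw moments; the variance follows by expanding the square.\<close>

lemma beta_density_moments:
  assumes "0 < \<mu>" "\<mu> < 1" "0 < \<phi>"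
  shows "has_bochner_integral lborel (beta_density \<mu> \<phi>) 1"
    and "has_bochner_integral lborel (\<lambda>y. beta_density \<mu> \<phi> y * y) \<mu>"
    and "has_bochner_integral lborel (\<lambda>y. beta_density \<mu> \<phi> y * (y - \<mu>)\<^sup>2) (\<mu> * (1 - \<mu>) / (1 + \<phi>))"
proof -
  define a b where "a = \<mu> * \<phi>" and "b = (1 - \<mu>) * \<phi>"
  have ab: "0 < a" "0 < b" "a + b = \<phi>"
    using assms by (auto simp: a_def b_def algebra_simps)
  have B: "Beta a b \<noteq> 0" using Beta_real_pos[of a b] ab by simp
  \<comment> \<open>The recurrence is stated away from the poles of Gamma; positive arguments avoid
    them.\<close>
  have npi: "x \<notin> \<int>\<^sub>\<le>\<^sub>0" if "0 < x" for x :: real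
    using that nonpos_Ints_nonpos by fastforce
  have "\<phi> * Beta (a + 1) b = a * Beta a b"
    using Beta_plus1_left[of a b] npi ab by simp
  then have B1: "Beta (a + 1) b = \<mu> * Beta a b"
    using assms by (simp add: a_def)
  \<comment> \<open>The recurrence once more, at \<open>a + 1\<close>; its factor
    \<open>a + 1 + b\<close> is the \<open>1 + \<phi>\<close> in the variance.\<close>
  have "(a + 1 + b) * Beta (a + 1 + 1) b = (a + 1) * Beta (a + 1) b"
    using Beta_plus1_left[of "a + 1" b] npi[of "a+1"] ab by simp
  moreover have "a + 1 + b = 1 + \<phi>"
    using ab by simp
  ultimately have "(1 + \<phi>) * Beta (a + 2) b = (a + 1) * \<mu> * Beta a b"
    by (simp only: B1 add.assoc one_add_one mult.assoc)
  then have B2: "Beta (a + 2) b = (a + 1) * \<mu> / (1 + \<phi>) * Beta a b"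
    using assms by (simp add: divide_simps mult_ac)
  note raw = beta_density_raw_moment[OF assms, folded a_def b_def]
  show m0: "has_bochner_integral lborel (beta_density \<mu> \<phi>) 1"
    using raw[of 0] B by simp
  show m1: "has_bochner_integral lborel (\<lambda>y. beta_density \<mu> \<phi> y * y) \<mu>"
    using raw[of 1] B B1 by simp
  have m2: "has_bochner_integral lborel (\<lambda>y. beta_density \<mu> \<phi> y * y\<^sup>2) ((a + 1) * \<mu> / (1 + \<phi>))"
    using raw[of 2] B B2 by simp
  have "has_bochner_integral lborel
      (\<lambda>y. beta_density \<mu> \<phi> y * y\<^sup>2 - 2 * \<mu> * (beta_density \<mu> \<phi> y * y) + \<mu>\<^sup>2 * beta_density \<mu> \<phi> y)
      ((a + 1) * \<mu> / (1 + \<phi>) - 2 * \<mu> * \<mu> + \<mu>\<^sup>2 * 1)"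
    by (intro has_bochner_integral_add has_bochner_integral_diff has_bochner_integral_mult_right m0 m1 m2)
  moreover have "(a + 1) * \<mu> / (1 + \<phi>) - 2 * \<mu> * \<mu> + \<mu>\<^sup>2 * 1 = \<mu> * (1 - \<mu>) / (1 + \<phi>)"
    using assms by (simp add: a_def divide_simps) (simp add: power2_eq_square algebra_simps)
  moreover have "beta_density \<mu> \<phi> y * y\<^sup>2 - 2 * \<mu> * (beta_density \<mu> \<phi> y * y) + \<mu>\<^sup>2 * beta_density \<mu> \<phi> y
      = beta_density \<mu> \<phi> y * (y - \<mu>)\<^sup>2" for y
    by (simp add: power2_eq_square algebra_simps)
  ultimately show "has_bochner_integral lborel (\<lambda>y. beta_density \<mu> \<phi> y * (y - \<mu>)\<^sup>2) (\<mu> * (1 - \<mu>) / (1 + \<phi>))"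
    by simp
qed

section \<open>The latent law: rescaling, moments and moment matching\<close>

lemma B4_density_nonneg:
  assumes "0 < \<mu>" "\<mu> < 1" "0 < \<phi>" "0 \<le> u"
  shows "0 \<le> B4_density \<mu> \<phi> u y"
  using assms by (simp add: B4_density_def beta_density_nonneg)

lemma B4_density_latent_affine:
  assumes "0 \<le> u"
  shows "B4_density \<mu> \<phi> u (- u + (1 + 2 * u) * x) = beta_density \<mu> \<phi> x / (1 + 2 * u)"
  using assms by (simp add: B4_density_def)

text \<open>The substitution \<open>y = - u + (1 + 2 * u) * x\<close> maps the unit interval to the
  latent support, and its Jacobian cancels the factor \<open>1 / (1 + 2 * u)\<close> in the density.
  All latent moments thus reduce to beta moments.\<close>

lemma has_bochner_integral_B4_density:
  assumes "0 \<le> u"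
    and "has_bochner_integral lborel (\<lambda>x. beta_density \<mu> \<phi> x * g (- u + (1 + 2 * u) * x)) r"
  shows "has_bochner_integral lborel (\<lambda>y. B4_density \<mu> \<phi> u y * g y) r"
proof -
  have "has_bochner_integral lborel
      (\<lambda>x. B4_density \<mu> \<phi> u (- u + (1 + 2 * u) * x) * g (- u + (1 + 2 * u) * x))
      (r /\<^sub>R \<bar>1 + 2 * u\<bar>)"
    unfolding B4_density_latent_affine[OF assms(1)]
    using has_bochner_integral_divide_zero[OF assms(2), of "1 + 2 * u"] assms(1)
    by (simp add: divide_inverse_commute mult.assoc)
  then show ?thesis
    using assms(1)
    by (subst lborel_has_bochner_integral_real_affine_iff[where c = "1 + 2 * u" and t = "- u"]) auto
qed

lemma integral_B4:
  assumes "0 < \<mu>" "\<mu> < 1" "0 < \<phi>" "0 \<le> u" and [measurable]: "g \<in> borel_measurable borel"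
  shows "integral\<^sup>L (B4 \<mu> \<phi> u) g = (\<integral>y. B4_density \<mu> \<phi> u y * g y \<partial>lborel)"
  using assms by (simp add: B4_def integral_density B4_density_nonneg)

lemma prob_space_B4:
  assumes "0 < \<mu>" "\<mu> < 1" "0 < \<phi>" "0 \<le> u"
  shows "prob_space (B4 \<mu> \<phi> u)"
proof
  have "has_bochner_integral lborel (B4_density \<mu> \<phi> u) 1"
    using has_bochner_integral_B4_density[of u \<mu> \<phi> "\<lambda>_. 1" 1] beta_density_moments(1) assms by simp
  then have "(\<integral>\<^sup>+y. ennreal (B4_density \<mu> \<phi> u y) \<partial>lborel) = ennreal 1"
    using assms by (subst nn_integral_eq_integral)
      (auto simp: has_bochner_integral_iff B4_density_nonneg)
  then show "emeasure (B4 \<mu> \<phi> u) (space (B4 \<mu> \<phi> u)) = 1"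
    by (simp add: B4_def emeasure_density)
qed

lemma expectation_B4:
  assumes "0 < \<mu>" "\<mu> < 1" "0 < \<phi>" "0 \<le> u"
  shows "prob_space.expectation (B4 \<mu> \<phi> u) (\<lambda>y. y) = (1 + 2 * u) * \<mu> - u"
proof -
  have "has_bochner_integral lborel (\<lambda>x. - u * beta_density \<mu> \<phi> x + (1 + 2 * u) * (beta_density \<mu> \<phi> x * x))
      (- u * 1 + (1 + 2 * u) * \<mu>)"
    using assms by (intro has_bochner_integral_add has_bochner_integral_mult_right beta_density_moments)
  then have "has_bochner_integral lborel (\<lambda>y. B4_density \<mu> \<phi> u y * y) ((1 + 2 * u) * \<mu> - u)"
    using assms by (intro has_bochner_integral_B4_density) (auto simp: algebra_simps)
  then show ?thesis
    using assms by (simp add: integral_B4 has_bochner_integral_iff)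
qed

lemma variance_B4:
  assumes "0 < \<mu>" "\<mu> < 1" "0 < \<phi>" "0 \<le> u"
  shows "prob_space.variance (B4 \<mu> \<phi> u) (\<lambda>y. y) = (1 + 2 * u)\<^sup>2 * (\<mu> * (1 - \<mu>)) / (1 + \<phi>)"
proof -
  let ?m = "(1 + 2 * u) * \<mu> - u"
  have "has_bochner_integral lborel (\<lambda>x. (1 + 2 * u)\<^sup>2 * (beta_density \<mu> \<phi> x * (x - \<mu>)\<^sup>2))
      ((1 + 2 * u)\<^sup>2 * (\<mu> * (1 - \<mu>) / (1 + \<phi>)))"
    using assms by (intro has_bochner_integral_mult_right beta_density_moments)
  moreover have "(1 + 2 * u)\<^sup>2 * (beta_density \<mu> \<phi> x * (x - \<mu>)\<^sup>2)
      = beta_density \<mu> \<phi> x * ((- u + (1 + 2 * u) * x) - ?m)\<^sup>2" for x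
    by (simp add: power2_eq_square algebra_simps)
  ultimately have "has_bochner_integral lborel (\<lambda>y. B4_density \<mu> \<phi> u y * (y - ?m)\<^sup>2)
      ((1 + 2 * u)\<^sup>2 * (\<mu> * (1 - \<mu>) / (1 + \<phi>)))"
    using assms by (intro has_bochner_integral_B4_density) auto
  then show ?thesis
    using assms unfolding expectation_B4[OF assms]
    by (simp add: integral_B4 has_bochner_integral_iff)
qed

text \<open>The mean equation is linear in \<mu>. Once it holds, the variance equation reads
  \<open>(m + u) * (1 + u - m) / (1 + \<phi>) = s\<^sup>2\<close>, which is solved for \<phi>. The
  assumptions place \<open>m\<close> strictly inside the latent support, so that \<mu> lies in the
  open unit interval.\<close>

lemma latent_moments_iff:
  assumes "0 < s" "0 \<le> u" "0 < m + u" "m < 1 + u"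
  shows "latent_moments m s u \<mu> \<phi> \<longleftrightarrow>
    0 < \<phi> \<and> \<mu> = (m + u) / (1 + 2 * u) \<and> \<phi> = (m + u) * (1 + u - m) / s\<^sup>2 - 1"
proof -
  have mu: "\<mu> = (m + u) / (1 + 2 * u) \<longleftrightarrow> (1 + 2 * u) * \<mu> - u = m"
    using assms by (auto simp: field_simps)
  have phi: "\<phi> = (m + u) * (1 + u - m) / s\<^sup>2 - 1 \<longleftrightarrow>
      (1 + 2 * u)\<^sup>2 * (\<mu> * (1 - \<mu>)) / (1 + \<phi>) = s\<^sup>2" 
    if "(1 + 2 * u) * \<mu> - u = m" "0 < \<phi>"
  proof -
    \<comment> \<open>One factor \<open>1 + 2 * u\<close> goes to each side: the mean equation turns
      \<open>(1 + 2 * u) * \<mu>\<close> into \<open>m + u\<close> and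
      \<open>(1 + 2 * u) * (1 - \<mu>)\<close> into \<open>1 + u - m\<close>.\<close>
    have "(1 + 2 * u)\<^sup>2 * (\<mu> * (1 - \<mu>)) = (m + u) * (1 + u - m)"
      unfolding that(1)[symmetric] by (simp add: power2_eq_square algebra_simps)
    then show ?thesis
      using that(2) assms by (simp add: field_simps) (auto simp: algebra_simps)
  qed
  have "0 < (m + u) / (1 + 2 * u)" "(m + u) / (1 + 2 * u) < 1"
    using assms by (auto simp: field_simps)
  then show ?thesis
    unfolding latent_moments_def using mu phi expectation_B4[of \<mu> \<phi> u] variance_B4[of \<mu> \<phi> u] assms
    by auto
qed

section \<open>The case without exceedance\<close>

text \<open>The density lives on the open unit interval, where censoring is the identity, so
  censoring changes nothing almost everywhere.\<close>

lemma XB_0: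
  assumes "0 < \<mu>" "\<mu> < 1" "0 < \<phi>"
  shows "XB \<mu> \<phi> 0 = beta_distribution \<mu> \<phi>"
proof -
  have B4: "B4 \<mu> \<phi> 0 = beta_distribution \<mu> \<phi>"
    by (simp add: B4_def beta_distribution_def B4_density_def)
  have "AE y in beta_distribution \<mu> \<phi>. censor01 y = y"
    unfolding beta_distribution_def
    by (subst AE_density) (auto simp: beta_density_def censor01_def indicator_def intro!: AE_I2)
  then have "distr (beta_distribution \<mu> \<phi>) borel censor01 = distr (beta_distribution \<mu> \<phi>) borel (\<lambda>y. y)"
    by (intro distr_cong_AE) (auto simp: beta_distribution_def)
  also have "\<dots> = beta_distribution \<mu> \<phi>"
    by (rule distr_id2) (simp add: beta_distribution_def)
  finally show ?thesis
    by (simp add: XB_def B4)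
qed

section \<open>A Gaussian bound for the recentred density\<close>

text \<open>The difference of the two sides has derivative
  \<open>x * (3 - x) / (4 * (1 + x))\<close>, nonpositive on (-1, 0] and nonnegative on [0, 3],
  hence its minimum is the value 0 at 0.\<close>

lemma ln_add_one_le_quadratic:
  assumes "- 1 < x" "x \<le> (3 :: real)"
  shows "ln (1 + x) \<le> x - x\<^sup>2 / 8"
proof -
  define f where "f x = x - x\<^sup>2 / 8 - ln (1 + x)" for x :: real
  have deriv: "(f has_real_derivative x * (3 - x) / (4 * (1 + x))) (at x)" if "- 1 < x" for x
    unfolding f_def using that
    by (auto intro!: derivative_eq_intros simp: field_simps power2_eq_square)
  have "f 0 \<le> f x"
  proof (cases "0 \<le> x")
    case True
    show ?thesis
    proof (rule DERIV_nonneg_imp_nondecreasing[OF True])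
      fix y assume "0 \<le> y" "y \<le> x"
      then show "\<exists>d. (f has_real_derivative d) (at y) \<and> 0 \<le> d"
        using deriv[of y] assms by (intro exI[of _ "y * (3 - y) / (4 * (1 + y))"] conjI) auto
    qed
  next
    case False
    then have "x \<le> 0" by simp
    then show ?thesis
    proof (rule DERIV_nonpos_imp_nonincreasing)
      fix y assume "x \<le> y" "y \<le> 0"
      then show "\<exists>d. (f has_real_derivative d) (at y) \<and> d \<le> 0"
        using deriv[of y] assms
        by (intro exI[of _ "y * (3 - y) / (4 * (1 + y))"] conjI)
           (auto intro!: divide_nonpos_nonneg mult_nonpos_nonneg)
    qed
  qed
  then show ?thesis by (simp add: f_def)
qed

text \<open>The beta kernel as a function of the deviation \<open>t\<close> from the mean, scaled to
  equal 1 at \<open>t = 0\<close>; \<open>p\<close> and \<open>q\<close> are the distances from the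
  mean to the two ends of the support. The exponential form exposes the exponent that is bounded and
  expanded later, and the indicator confines it to positive arguments of \<open>ln\<close>.\<close>

definition centred_shape :: "real \<Rightarrow> real \<Rightarrow> real \<Rightarrow> real \<Rightarrow> real \<Rightarrow> real" where
  "centred_shape a b p q t =
     indicator {- p<..<q} t * exp ((a - 1) * ln (1 + t / p) + (b - 1) * ln (1 - t / q))"

lemma borel_measurable_centred_shape [measurable]: "centred_shape a b p q \<in> borel_measurable borel"
  unfolding centred_shape_def[abs_def] by measurable

text \<open>When \<mu> matches the mean \<open>m\<close>, the rescaled point and its complement
  factor as \<open>\<mu> * (1 + t / p)\<close> and \<open>(1 - \<mu>) * (1 - t / q)\<close>.
  Splitting the powers leaves the density at \<open>m\<close> as the constant.\<close>

lemma B4_density_eq_centred_shape: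
  assumes "0 \<le> u" "0 < m + u" "m < 1 + u" and \<mu>: "\<mu> = (m + u) / (1 + 2 * u)"
  shows "B4_density \<mu> \<phi> u (m + t) =
    B4_density \<mu> \<phi> u m * centred_shape (\<mu> * \<phi>) ((1 - \<mu>) * \<phi>) (m + u) (1 + u - m) t"
proof -
  define p q L where "p = m + u" and "q = 1 + u - m" and "L = 1 + 2 * u"
  have pos: "0 < p" "0 < q" "0 < L" and L: "L = p + q"
    using assms by (auto simp: p_def q_def L_def)
  have "\<mu> = p / L"
    by (simp add: \<mu> p_def L_def)
  moreover from this have "1 - \<mu> = q / L"
    using pos by (simp add: L field_simps)
  ultimately have \<mu>': "\<mu> = p / L" "1 - \<mu> = q / L" .
  have "\<mu> * (1 + t / p) = (p + t) / L"
    unfolding \<mu>'(1) using pos by (simp add: divide_simps)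
  moreover have "(1 - \<mu>) * (1 - t / q) = (q - t) / L"
    unfolding \<mu>'(2) using pos by (simp add: divide_simps)
  moreover have "m + t + u = p + t" "1 - (p + t) / L = (q - t) / L"
    using pos by (simp_all add: p_def) (simp add: p_def[symmetric] L field_simps)
  ultimately have scale: "(m + t + u) / L = \<mu> * (1 + t / p)"
    "1 - (m + t + u) / L = (1 - \<mu>) * (1 - t / q)" "(m + u) / L = \<mu>"
    using \<mu>'(1) by (simp_all only: p_def[symmetric])
  show ?thesis
  proof (cases "t \<in> {- p<..<q}")
    case True
    then have t: "0 < 1 + t / p" "0 < 1 - t / q"
      using pos by (auto simp: field_simps)
    have \<mu>01: "0 < \<mu>" "\<mu> < 1"
      using pos unfolding \<mu>' by (auto simp: L field_simps)
    have f: "B4_density \<mu> \<phi> u (m + t) = beta_density \<mu> \<phi> (\<mu> * (1 + t / p)) / L"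
      "B4_density \<mu> \<phi> u m = beta_density \<mu> \<phi> \<mu> / L"
      by (simp_all only: B4_density_def L_def[symmetric] scale mult_1_right times_divide_eq_right)
    have compl: "1 - \<mu> * (1 + t / p) = (1 - \<mu>) * (1 - t / q)"
      using scale by simp
    moreover have "0 < \<mu> * (1 + t / p)" "0 < (1 - \<mu>) * (1 - t / q)"
      using t \<mu>01 by auto
    ultimately have "\<mu> * (1 + t / p) \<in> {0<..<1}" "\<mu> \<in> {0<..<1}"
      using \<mu>01 by auto
    then show ?thesis
      using True t \<mu>01
      unfolding f beta_density_def centred_shape_def compl p_def[symmetric] q_def[symmetric]
      by (simp add: powr_mult exp_add powr_def[of "1 + t / p"] powr_def[of "1 - t / q"])
  next
    \<comment> \<open>Beyond the ends of the support both indicators vanish.\<close>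
    case False
    then have "(m + t + u) / L \<notin> {0<..<1}"
      using pos by (auto simp: p_def q_def L_def field_simps)
    with False show ?thesis
      by (simp add: B4_density_def beta_density_def centred_shape_def L_def p_def q_def)
  qed
qed

text \<open>Bounding both logarithms quadratically leaves a linear term of size at most
  \<open>\<bar>t\<bar>\<close> and a negative quadratic term that absorbs it. The two ratio
  conditions on \<open>p\<close> and \<open>q\<close> keep \<open>t / p\<close> and
  \<open>- t / q\<close> below 3, and \<open>1 \<le> a\<close>, \<open>1 \<le> b\<close> preserve
  the direction of the logarithmic bounds.\<close>

lemma centred_shape_le_gaussian:
  assumes "0 < p" "0 < q" "p \<le> 3 * q" "q \<le> 3 * p" "1 \<le> a" "1 \<le> b" "0 < s"
    and lin: "\<bar>(a - 1) / p - (b - 1) / q\<bar> \<le> 1"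
    and quad: "1 / (2 * s\<^sup>2) \<le> (a - 1) / p\<^sup>2 + (b - 1) / q\<^sup>2"
  shows "centred_shape a b p q (s * z) \<le> exp (8 * s\<^sup>2) * exp (- z\<^sup>2 / 32)"
proof (cases "s * z \<in> {- p<..<q}")
  case True
  define t where "t = s * z"
  have t: "- p < t" "t < q" using True by (auto simp: t_def)
  have "(a - 1) * ln (1 + t / p) \<le> (a - 1) * (t / p - (t / p)\<^sup>2 / 8)"
    using t assms by (intro mult_left_mono ln_add_one_le_quadratic) (auto simp: field_simps)
  moreover have "(b - 1) * ln (1 + (- t / q)) \<le> (b - 1) * (- t / q - (- t / q)\<^sup>2 / 8)"
    using t assms by (intro mult_left_mono ln_add_one_le_quadratic) (auto simp: field_simps)
  ultimately have "(a - 1) * ln (1 + t / p) + (b - 1) * ln (1 - t / q) \<le>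
      ((a - 1) / p - (b - 1) / q) * t - ((a - 1) / p\<^sup>2 + (b - 1) / q\<^sup>2) * (t\<^sup>2 / 8)"
    by (simp add: algebra_simps power_divide)
  moreover have "((a - 1) / p - (b - 1) / q) * t \<le> \<bar>t\<bar>"
    using mult_right_mono[OF lin abs_ge_zero[of t]]
    by - (rule order_trans[OF abs_ge_self], simp add: abs_mult)
  moreover have "z\<^sup>2 / 16 \<le> ((a - 1) / p\<^sup>2 + (b - 1) / q\<^sup>2) * (t\<^sup>2 / 8)"
    using mult_right_mono[OF quad, of "t\<^sup>2 / 8"] \<open>0 < s\<close> by (simp add: t_def power_mult_distrib)
  moreover have "\<bar>t\<bar> \<le> 8 * s\<^sup>2 + z\<^sup>2 / 32"
  proof -
    \<comment> \<open>The number 16 is chosen so that division by 32 gives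
      \<open>s * \<bar>z\<bar> \<le> 8 * s\<^sup>2 + z\<^sup>2 / 32\<close>, which costs just half
      of the available \<open>z\<^sup>2 / 16\<close>.\<close>
    have "0 \<le> (\<bar>z\<bar> - 16 * s)\<^sup>2" by simp
    then show ?thesis
      using \<open>0 < s\<close> by (simp add: power2_diff abs_mult t_def power_mult_distrib mult.commute[of s])
  qed
  ultimately have "(a - 1) * ln (1 + t / p) + (b - 1) * ln (1 - t / q) \<le> 8 * s\<^sup>2 + - z\<^sup>2 / 32"
    by linarith
  then show ?thesis
    using True unfolding exp_add[symmetric] by (simp add: centred_shape_def t_def)
qed (simp add: centred_shape_def)

section \<open>Asymptotics under fixed mean and variance\<close>

definition latent_mu :: "real \<Rightarrow> real \<Rightarrow> real" where
  "latent_mu m u = (m + u) / (1 + 2 * u)"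

definition latent_phi :: "real \<Rightarrow> real \<Rightarrow> real \<Rightarrow> real" where
  "latent_phi m s u = (m + u) * (1 + u - m) / s\<^sup>2 - 1"

definition standardised_shape :: "real \<Rightarrow> real \<Rightarrow> real \<Rightarrow> real \<Rightarrow> real" where
  "standardised_shape m s u z =
     centred_shape (latent_mu m u * latent_phi m s u) ((1 - latent_mu m u) * latent_phi m s u)
       (m + u) (1 + u - m) (s * z)"

lemma borel_measurable_standardised_shape [measurable]:
  "standardised_shape m s u \<in> borel_measurable borel"
  unfolding standardised_shape_def[abs_def] by measurable

text \<open>For large \<open>u\<close> the mean lies inside the support and the solved \<phi> is
  positive. The threshold depends only on \<open>m\<close> and \<open>s\<close>, so the quantifiers
  over the parameters stay inside; this yields both existence and uniqueness.\<close>

lemma eventually_latent_moments_iff: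
  assumes "0 < s"
  shows "\<forall>\<^sub>F u in at_top. \<forall>\<mu> \<phi>. latent_moments m s u \<mu> \<phi> \<longleftrightarrow> \<mu> = latent_mu m u \<and> \<phi> = latent_phi m s u"
proof -
  have "\<forall>\<^sub>F u in at_top. 0 < latent_phi m s u"
    unfolding latent_phi_def using assms by real_asymp
  moreover have "\<forall>\<^sub>F u in at_top. 0 < m + u" "\<forall>\<^sub>F u in at_top. m < 1 + u"
    by real_asymp+
  moreover have "\<forall>\<^sub>F u in at_top. (0 :: real) \<le> u"
    by (rule eventually_ge_at_top)
  ultimately show ?thesis
    by eventually_elim (auto simp: latent_moments_iff[OF assms] latent_mu_def latent_phi_def)
qed

text \<open>With a, b the two shape parameters and p, q the distances to the ends, a / p = b / q
  exactly, so the first-order terms of the exponent cancel in the limit; (a - 1) / p^2 + (b - 1) /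
  q^2 tends to 1 / s^2, so the second-order terms give \<open>- z\<^sup>2 / 2\<close>.\<close>

lemma standardised_shape_tendsto:
  assumes "0 < s"
  shows "((\<lambda>u. standardised_shape m s u z) \<longlongrightarrow> exp (- z\<^sup>2 / 2)) at_top"
proof -
  define E where "E u =
    (latent_mu m u * latent_phi m s u - 1) * ln (1 + s * z / (m + u)) +
    ((1 - latent_mu m u) * latent_phi m s u - 1) * ln (1 - s * z / (1 + u - m))" for u
  have "(E \<longlongrightarrow> - z\<^sup>2 / 2) at_top"
    unfolding E_def latent_mu_def latent_phi_def using assms
    by real_asymp (simp add: field_simps power2_eq_square)
  then have "((\<lambda>u. exp (E u)) \<longlongrightarrow> exp (- z\<^sup>2 / 2)) at_top"
    by (rule tendsto_exp)
  moreover have "\<forall>\<^sub>F u in at_top. - (m + u) < s * z" "\<forall>\<^sub>F u in at_top. s * z < 1 + u - m"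
    by real_asymp+
  then have "\<forall>\<^sub>F u in at_top. exp (E u) = standardised_shape m s u z"
    by eventually_elim (simp add: standardised_shape_def centred_shape_def E_def)
  ultimately show ?thesis
    by (rule Lim_transform_eventually)
qed

lemma standardised_shape_dominated:
  assumes "0 < s"
  shows "\<forall>\<^sub>F u in at_top. \<forall>z. norm (standardised_shape m s u z) \<le> exp (8 * s\<^sup>2) * exp (- z\<^sup>2 / 32)"
proof -
  let ?a = "\<lambda>u. latent_mu m u * latent_phi m s u"
  let ?b = "\<lambda>u. (1 - latent_mu m u) * latent_phi m s u"
  note defs = latent_mu_def latent_phi_def
  have "((\<lambda>u. (?a u - 1) / (m + u)\<^sup>2 + (?b u - 1) / (1 + u - m)\<^sup>2) \<longlongrightarrow> inverse (s\<^sup>2)) at_top"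
    unfolding defs using assms by real_asymp
  \<comment> \<open>Half of the limit is eventually exceeded.\<close>
  then have quad: "\<forall>\<^sub>F u in at_top. 1 / (2 * s\<^sup>2) < (?a u - 1) / (m + u)\<^sup>2 + (?b u - 1) / (1 + u - m)\<^sup>2"
    by (rule order_tendstoD) (use assms in \<open>simp add: field_simps\<close>)
  have "((\<lambda>u. (?a u - 1) / (m + u) - (?b u - 1) / (1 + u - m)) \<longlongrightarrow> 0) at_top"
    unfolding defs using assms by real_asymp (simp add: field_simps)
  then have lin: "\<forall>\<^sub>F u in at_top. \<bar>(?a u - 1) / (m + u) - (?b u - 1) / (1 + u - m)\<bar> < 1"
    by (intro order_tendstoD(2)[OF tendsto_rabs_zero]) auto
  have ab: "\<forall>\<^sub>F u in at_top. 1 \<le> ?a u" "\<forall>\<^sub>F u in at_top. 1 \<le> ?b u"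
    unfolding defs using assms by real_asymp+
  have pq: "\<forall>\<^sub>F u in at_top. 0 < m + u" "\<forall>\<^sub>F u in at_top. 0 < 1 + u - m"
    "\<forall>\<^sub>F u in at_top. m + u \<le> 3 * (1 + u - m)" "\<forall>\<^sub>F u in at_top. 1 + u - m \<le> 3 * (m + u)"
    by real_asymp+
  from pq(1) pq(2) pq(3) pq(4) ab lin quad show ?thesis
  proof eventually_elim
    case (elim u)
    have "0 \<le> standardised_shape m s u z" for z
      by (simp add: standardised_shape_def centred_shape_def)
    moreover have "standardised_shape m s u z \<le> exp (8 * s\<^sup>2) * exp (- z\<^sup>2 / 32)" for z
      unfolding standardised_shape_def
      by (rule centred_shape_le_gaussian) (use elim assms in auto)
    ultimately show ?case by auto
  qed
qed

section \<open>Convergence of latent probabilities\<close>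

lemma integral_standardised_shape_tendsto:
  assumes "0 < s" and [measurable]: "A \<in> sets borel"
  shows "((\<lambda>u. \<integral>z. indicator A (m + s * z) * standardised_shape m s u z \<partial>lborel) \<longlongrightarrow>
    (\<integral>z. indicator A (m + s * z) * exp (- z\<^sup>2 / 2) \<partial>lborel)) at_top"
proof (rule integral_dominated_convergence_at_top)
  \<comment> \<open>The dominating function is a multiple of the normal density with standard
    deviation 4, as 2 * 4^2 = 32.\<close>
  have "integrable lborel (\<lambda>z. exp (8 * s\<^sup>2) * sqrt (2 * pi * 4\<^sup>2) * normal_density 0 4 z)"
    by (intro integrable_mult_right integrable_normal_density) simp
  then show "integrable lborel (\<lambda>z. exp (8 * s\<^sup>2) * exp (- z\<^sup>2 / 32))"
    by (simp add: normal_density_def)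
  show "AE z in lborel. ((\<lambda>u. indicator A (m + s * z) * standardised_shape m s u z) \<longlongrightarrow>
      indicator A (m + s * z) * exp (- z\<^sup>2 / 2)) at_top"
    by (intro AE_I2 tendsto_intros standardised_shape_tendsto assms)
  show "\<forall>\<^sub>F u in at_top. AE z in lborel.
      norm (indicator A (m + s * z) * standardised_shape m s u z) \<le> exp (8 * s\<^sup>2) * exp (- z\<^sup>2 / 32)"
    using standardised_shape_dominated[OF assms(1), of m]
  proof eventually_elim
    case (elim u)
    have "norm (indicator A (m + s * z) * standardised_shape m s u z) \<le> norm (standardised_shape m s u z)" for z
      by (simp add: indicator_def)
    with elim show ?case
      by (intro AE_I2) (blast intro: order_trans)
  qed
qed measurable

lemma measure_normal_affine:
  assumes [measurable]: "A \<in> sets borel"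
  shows "(\<integral>z. indicator A (m + s * z) * exp (- z\<^sup>2 / 2) \<partial>lborel) =
    sqrt (2 * pi) * measure std_normal_distribution {z. m + s * z \<in> A}"
proof -
  have [measurable]: "{z. m + s * z \<in> A} \<in> sets borel" by measurable
  have "measure std_normal_distribution {z. m + s * z \<in> A} =
      integral\<^sup>L std_normal_distribution (indicator {z. m + s * z \<in> A})"
    by simp
  also have "\<dots> = (\<integral>z. std_normal_density z * indicator {z. m + s * z \<in> A} z \<partial>lborel)"
    by (subst integral_density) auto
  also have "\<dots> = (\<integral>z. 1 / sqrt (2 * pi) * (indicator A (m + s * z) * exp (- z\<^sup>2 / 2)) \<partial>lborel)"
    by (intro Bochner_Integration.integral_cong) (auto simp: std_normal_density_def indicator_def)
  finally show ?thesis
    by simp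
qed

text \<open>After the substitution \<open>y = m + s * z\<close> every probability is one constant
  \<open>c\<close> times an integral of the shape; taking the whole line determines
  \<open>c\<close>.\<close>

lemma measure_B4_eq_ratio:
  assumes lm: "latent_moments m s u (latent_mu m u) (latent_phi m s u)"
    and u: "0 < s" "0 \<le> u" "0 < m + u" "m < 1 + u" and [measurable]: "A \<in> sets borel"
  shows "measure (B4 (latent_mu m u) (latent_phi m s u) u) A =
    (\<integral>z. indicator A (m + s * z) * standardised_shape m s u z \<partial>lborel) /
    (\<integral>z. standardised_shape m s u z \<partial>lborel)"
proof -
  let ?\<mu> = "latent_mu m u" and ?\<phi> = "latent_phi m s u"
  let ?M = "B4 ?\<mu> ?\<phi> u"
  define c where "c = s * B4_density ?\<mu> ?\<phi> u m"
  have par: "0 < ?\<mu>" "?\<mu> < 1" "0 < ?\<phi>"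
    using lm by (auto simp: latent_moments_def)
  interpret prob_space ?M
    using par u by (intro prob_space_B4)
  have sets: "sets ?M = sets borel" by (simp add: B4_def)
  have *: "measure ?M B = c * (\<integral>z. indicator B (m + s * z) * standardised_shape m s u z \<partial>lborel)"
    if [measurable]: "B \<in> sets borel" for B
  proof -
    have "measure ?M B = integral\<^sup>L ?M (indicator B)"
      using sets that by simp
    also have "\<dots> = (\<integral>y. B4_density ?\<mu> ?\<phi> u y * indicator B y \<partial>lborel)"
      using par u by (intro integral_B4) auto
    also have "\<dots> = s * (\<integral>z. B4_density ?\<mu> ?\<phi> u (m + s * z) * indicator B (m + s * z) \<partial>lborel)"
      using u by (subst lborel_integral_real_affine[where c = s and t = m]) auto
    also have "(\<lambda>z. B4_density ?\<mu> ?\<phi> u (m + s * z) * indicator B (m + s * z)) =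
        (\<lambda>z. B4_density ?\<mu> ?\<phi> u m * (indicator B (m + s * z) * standardised_shape m s u z))"
      using u by (subst B4_density_eq_centred_shape) (auto simp: latent_mu_def standardised_shape_def mult_ac)
    finally show ?thesis
      by (simp add: c_def)
  qed
  \<comment> \<open>Total mass 1 also shows that the integral is nonzero, which permits the
    division.\<close>
  have "c * (\<integral>z. standardised_shape m s u z \<partial>lborel) = 1"
    using *[of UNIV] prob_space sets_eq_imp_space_eq[OF sets] by simp
  then have "c = 1 / (\<integral>z. standardised_shape m s u z \<partial>lborel)"
    by (metis mult_zero_right nonzero_eq_divide_eq zero_neq_one)
  then show ?thesis
    using * by simp
qed

lemma measure_B4_tendsto_normal:
  assumes "0 < s" and A: "A \<in> sets borel"
  shows "((\<lambda>u. measure (B4 (latent_mu m u) (latent_phi m s u) u) A) \<longlongrightarrow>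
    measure std_normal_distribution {z. m + s * z \<in> A}) at_top"
proof -
  interpret normal: prob_space std_normal_distribution
    by (rule prob_space_normal_density) simp
  have "((\<lambda>u. \<integral>z. indicator A (m + s * z) * standardised_shape m s u z \<partial>lborel) \<longlongrightarrow>
      sqrt (2 * pi) * measure std_normal_distribution {z. m + s * z \<in> A}) at_top"
    using integral_standardised_shape_tendsto[OF assms, of m] measure_normal_affine[OF A, of m s] by simp
  \<comment> \<open>The denominator is the case of the whole line; its limit is nonzero, so the
    quotient converges.\<close>
  moreover have "((\<lambda>u. \<integral>z. standardised_shape m s u z \<partial>lborel) \<longlongrightarrow> sqrt (2 * pi)) at_top"
    using integral_standardised_shape_tendsto[OF \<open>0 < s\<close>, of UNIV m]
      measure_normal_affine[of UNIV m s] normal.prob_space by simp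
  ultimately have "((\<lambda>u. (\<integral>z. indicator A (m + s * z) * standardised_shape m s u z \<partial>lborel) /
        (\<integral>z. standardised_shape m s u z \<partial>lborel)) \<longlongrightarrow>
      sqrt (2 * pi) * measure std_normal_distribution {z. m + s * z \<in> A} / sqrt (2 * pi)) at_top"
    by (rule tendsto_divide) simp
  moreover have "\<forall>\<^sub>F u in at_top. 0 < m + u" "\<forall>\<^sub>F u in at_top. m < 1 + u"
    by real_asymp+
  with eventually_latent_moments_iff[OF \<open>0 < s\<close>, of m] eventually_ge_at_top[of 0]
  have "\<forall>\<^sub>F u in at_top. (\<integral>z. indicator A (m + s * z) * standardised_shape m s u z \<partial>lborel) /
        (\<integral>z. standardised_shape m s u z \<partial>lborel) =
      measure (B4 (latent_mu m u) (latent_phi m s u) u) A"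
    by eventually_elim (rule measure_B4_eq_ratio[symmetric], use assms in auto)
  ultimately show ?thesis
    by (auto intro: Lim_transform_eventually)
qed

section \<open>Censoring and conclusion\<close>

lemma XB_weak_conv_censored_normal:
  assumes "0 < s"
  shows "weak_conv_along (\<lambda>u. XB (latent_mu m u) (latent_phi m s u) u)
    (distr std_normal_distribution borel (\<lambda>z. censor01 (m + s * z))) at_top"
  unfolding weak_conv_along_def
proof (intro allI impI)
  fix x
  let ?A = "censor01 -` {..x}"
  have A: "?A \<in> sets borel"
    using measurable_sets_borel[OF borel_measurable_censor01, of "{..x}"] by simp
  have "cdf (XB (latent_mu m u) (latent_phi m s u) u) x = measure (B4 (latent_mu m u) (latent_phi m s u) u) ?A" for u
    by (simp add: cdf_def XB_def measure_distr B4_def)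
  moreover have "cdf (distr std_normal_distribution borel (\<lambda>z. censor01 (m + s * z))) x =
      measure std_normal_distribution {z. m + s * z \<in> ?A}"
    by (simp add: cdf_def measure_distr vimage_def)
  ultimately show "((\<lambda>u. cdf (XB (latent_mu m u) (latent_phi m s u) u) x) \<longlongrightarrow>
      cdf (distr std_normal_distribution borel (\<lambda>z. censor01 (m + s * z))) x) at_top"
    using measure_B4_tendsto_normal[OF assms A, of m] by simp
qed

text \<open>The existence clause ensures that the convergence statement is not vacuous.\<close>

theorem mainTheorem2:
  shows "(\<forall>\<mu> \<phi> :: real. 0 < \<mu> \<and> \<mu> < 1 \<and> 0 < \<phi> \<longrightarrow> XB \<mu> \<phi> 0 = beta_distribution \<mu> \<phi>) \<and>
         (\<forall>m s :: real. 0 < s \<longrightarrow>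
            (\<forall>\<^sub>F u in at_top. \<exists>\<mu> \<phi>. latent_moments m s u \<mu> \<phi>) \<and>
            (\<forall>\<mu> \<phi> :: real \<Rightarrow> real.
               (\<forall>\<^sub>F u in at_top. latent_moments m s u (\<mu> u) (\<phi> u)) \<longrightarrow>
               weak_conv_along (\<lambda>u. XB (\<mu> u) (\<phi> u) u)
                 (distr std_normal_distribution borel (\<lambda>z. censor01 (m + s * z))) at_top))"
proof (intro conjI allI impI)
  fix \<mu> \<phi> :: real
  assume "0 < \<mu> \<and> \<mu> < 1 \<and> 0 < \<phi>"
  then show "XB \<mu> \<phi> 0 = beta_distribution \<mu> \<phi>"
    by (intro XB_0) auto
next
  fix m s :: real
  assume s: "0 < s"
  show "\<forall>\<^sub>F u in at_top. \<exists>\<mu> \<phi>. latent_moments m s u \<mu> \<phi>"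
    using eventually_latent_moments_iff[OF s, of m] by eventually_elim blast
  fix \<mu> \<phi> :: "real \<Rightarrow> real"
  assume "\<forall>\<^sub>F u in at_top. latent_moments m s u (\<mu> u) (\<phi> u)"
  with eventually_latent_moments_iff[OF s, of m]
  \<comment> \<open>By uniqueness any admissible family eventually coincides with the explicit one,
    and a limit at infinity depends only on eventual values.\<close>
  have eq: "\<forall>\<^sub>F u in at_top. \<mu> u = latent_mu m u \<and> \<phi> u = latent_phi m s u"
    by eventually_elim blast
  show "weak_conv_along (\<lambda>u. XB (\<mu> u) (\<phi> u) u)
      (distr std_normal_distribution borel (\<lambda>z. censor01 (m + s * z))) at_top"
    unfolding weak_conv_along_def
  proof (intro allI impI)
    fix x
    assume "isCont (cdf (distr std_normal_distribution borel (\<lambda>z. censor01 (m + s * z)))) x"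
    then have "((\<lambda>u. cdf (XB (latent_mu m u) (latent_phi m s u) u) x) \<longlongrightarrow>
        cdf (distr std_normal_distribution borel (\<lambda>z. censor01 (m + s * z))) x) at_top"
      using XB_weak_conv_censored_normal[OF s, of m] by (simp add: weak_conv_along_def)
    then show "((\<lambda>u. cdf (XB (\<mu> u) (\<phi> u) u) x) \<longlongrightarrow>
        cdf (distr std_normal_distribution borel (\<lambda>z. censor01 (m + s * z))) x) at_top"
      by (rule Lim_transform_eventually) (use eq in eventually_elim, simp)
  qed
qed

end
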